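(* Let $F$ be a field of characteristic $\neq 2$. For every integer $q\ge 3$ and every real number $\sigma\in(0,1)$ there exists a finitely generated Lie algebra $\mathfrak{g}$ over $F$ such that $\operatorname{Dim}^q(\gamma_{\mathfrak{g}}(n))=\underline{\operatorname{Dim}}^q(\gamma_{\mathfrak{g}}(n))=\sigma$.
   Context: For a finitely generated Lie algebra $\mathfrak{g}$ over $F$ and a finite-dimensional subspace $V\subseteq\mathfrak{g}$ generating $\mathfrak{g}$ as a Lie algebra, the growth function is $\gamma_{\mathfrak{g}}(n)=\gamma_{\mathfrak{g},V}(n)=\dim_F\big(\sum_{i=1}^{n}V^{[i]}\big)$, where $V^{[i]}$ is the span of all length-$i$ Lie products of elements of $V$. It is independent of $V$ up to the equivalence relation $\sim$, where $f\preceq g$ means that there are $C,D>0$ with $f(n)\le Cg(Dn)$ for all $n\in\mathbb{N}$, and $f\sim g$ means $f\preceq g$ and $g\preceq f$. Put $\ln^{(1)}n=\ln n$ and $\ln^{(k+1)}n=\ln(\ln^{(k)}n)$. For real $\alpha>0$ and sufficiently large $n$ define $$\Phi^3_\alpha(n)=\exp\big(n^{\alpha/(\alpha+1)}\big),\qquad \Phi^q_\alpha(n)=\exp\left(\frac{n}{(\ln^{(q-3)}n)^{1/\alpha}}\right)\ \text{ for } q=4,5,\dots$$ For a function $f$ on $\mathbb{N}$ define the $q$-dimensions $$\operatorname{Dim}^q f=\inf\{\alpha\in\mathbb{R}^+ : f(n)\le\Phi^q_\alpha(n)\text{ for all sufficiently large } n\},$$ $$\underline{\operatorname{Dim}}^q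 f=\sup\{\alpha\in\mathbb{R}^+ : f(n)\ge\Phi^q_\alpha(n)\text{ for all sufficiently large } n\},$$ with the conventions $\inf\emptyset=\infty$ and $\sup\emptyset=0$. *)

theory Defs
  imports
    Complex_Main
    "HOL-Library.Extended_Nonnegative_Real"
    "HOL-Computational_Algebra.Computational_Algebra"
begin

text \<open>
  A Lie algebra over the field \<open>'f\<close> is carried by a subspace \<open>L\<close> of an ambient vector space, so
  that Lie algebras of every dimension up to that of the ambient space can live on one type.
  The bracket is a total function whose values outside \<open>L\<close> are irrelevant. The bracket is
  required to be alternating, not merely antisymmetric.
\<close>

locale lie_algebra = vector_space scale
  for scale :: "'f::field \<Rightarrow> 'v::ab_group_add \<Rightarrow> 'v" +
  fixes L :: "'v set"
    and bracket :: "'v \<Rightarrow> 'v \<Rightarrow> 'v"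
  assumes subspace_carrier: "subspace L"
    and bracket_closed: "\<lbrakk>x \<in> L; y \<in> L\<rbrakk> \<Longrightarrow> bracket x y \<in> L"
    and bracket_add_left:
      "\<lbrakk>x \<in> L; y \<in> L; z \<in> L\<rbrakk> \<Longrightarrow> bracket (x + y) z = bracket x z + bracket y z"
    and bracket_add_right:
      "\<lbrakk>x \<in> L; y \<in> L; z \<in> L\<rbrakk> \<Longrightarrow> bracket x (y + z) = bracket x y + bracket x z"
    and bracket_scale_left:
      "\<lbrakk>x \<in> L; y \<in> L\<rbrakk> \<Longrightarrow> bracket (scale c x) y = scale c (bracket x y)"
    and bracket_scale_right:
      "\<lbrakk>x \<in> L; y \<in> L\<rbrakk> \<Longrightarrow> bracket x (scale c y) = scale c (bracket x y)"
    and bracket_self: "x \<in> L \<Longrightarrow> bracket x x = 0"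
    and jacobi:
      "\<lbrakk>x \<in> L; y \<in> L; z \<in> L\<rbrakk> \<Longrightarrow>
        bracket x (bracket y z) + bracket y (bracket z x) + bracket z (bracket x y) = 0"
begin

definition lie_subalgebra :: "'v set \<Rightarrow> bool" where
  "lie_subalgebra S \<longleftrightarrow> subspace S \<and> S \<subseteq> L \<and> (\<forall>x\<in>S. \<forall>y\<in>S. bracket x y \<in> S)"

definition fin_dim_generating_subspace :: "'v set \<Rightarrow> bool" where
  "fin_dim_generating_subspace V \<longleftrightarrow>
     subspace V \<and> V \<subseteq> L \<and> (\<exists>B. finite B \<and> span B = V) \<and> lie_subalgebra hull V = L"

definition finitely_generated :: bool where
  "finitely_generated \<longleftrightarrow> (\<exists>X. finite X \<and> X \<subseteq> L \<and> lie_subalgebra hull X = L)"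

text \<open>Lie products of length \<open>i\<close>, with arbitrary bracketing.\<close>

inductive lie_product :: "'v set \<Rightarrow> nat \<Rightarrow> 'v \<Rightarrow> bool" for V where
  generator: "v \<in> V \<Longrightarrow> lie_product V 1 v"
| product: "\<lbrakk>lie_product V i x; lie_product V j y\<rbrakk> \<Longrightarrow> lie_product V (i + j) (bracket x y)"

definition lie_power :: "'v set \<Rightarrow> nat \<Rightarrow> 'v set" where
  "lie_power V i = span {x. lie_product V i x}"

text \<open>The sum of the subspaces \<open>lie_power V i\<close> is rendered as the span of their union.\<close>

definition growth :: "'v set \<Rightarrow> nat \<Rightarrow> nat" where
  "growth V n = dim (span (\<Union>i\<in>{1..n}. lie_power V i))"

end

text \<open>Only meaningful for \<open>q \<ge> 3\<close>, \<open>\<alpha> > 0\<close> and \<open>n\<close> large enough that the iterated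
  logarithm is positive.\<close>

definition Phi :: "nat \<Rightarrow> real \<Rightarrow> nat \<Rightarrow> real" where
  "Phi q \<alpha> n =
    (if q = 3 then exp (real n powr (\<alpha> / (\<alpha> + 1)))
     else exp (real n / ((ln ^^ (q - 3)) (real n) powr (1 / \<alpha>))))"

text \<open>The values are in \<open>ennreal\<close>, where \<open>Inf {} = \<infinity>\<close> and \<open>Sup {} = 0\<close>.\<close>

definition upper_qdim :: "nat \<Rightarrow> (nat \<Rightarrow> real) \<Rightarrow> ennreal" where
  "upper_qdim q f = Inf (ennreal ` {\<alpha>. \<alpha> > 0 \<and> (\<forall>\<^sub>F n in sequentially. f n \<le> Phi q \<alpha> n)})"

definition lower_qdim :: "nat \<Rightarrow> (nat \<Rightarrow> real) \<Rightarrow> ennreal" where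
  "lower_qdim q f = Sup (ennreal ` {\<alpha>. \<alpha> > 0 \<and> (\<forall>\<^sub>F n in sequentially. f n \<ge> Phi q \<alpha> n)})"

end

theory Submission
  imports Defs "HOL-Library.Sublist" "HOL-Real_Asymp.Real_Asymp"
begin

text \<open>
  Up to the constants that the dimensions ignore, the target growth is
  \<open>exp (n / g n)\<close> for a sublinear gap function \<open>g\<close>: with \<open>B n\<close> the \<open>(q - 3)\<close>-fold iterated
  logarithm of \<open>n\<close> (so \<open>B n = n\<close> for \<open>q = 3\<close>), \<open>Phi q \<alpha> n = exp (n / B n powr e \<alpha>)\<close> with an exponent
  \<open>e \<alpha>\<close> that decreases strictly in \<open>\<alpha>\<close>, and one takes \<open>g = B powr e \<sigma>\<close>. It therefore suffices
  that the growth lies between \<open>exp (n / g n powr r)\<close> for every \<open>r > 1\<close> and the same expression for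
  every \<open>r < 1\<close>.

  Such a growth is easy to realise for languages. Consider the binary words in which every factor
  of length \<open>m\<close> has at most \<open>m / g m + 1\<close> occurrences of \<open>True\<close>. This condition passes to factors.
  A word whose occurrences of \<open>True\<close> sit at arbitrarily chosen multiples of \<open>d = \<lceil>g n\<rceil>\<close> satisfies
  it, which gives \<open>2 ^ (n div d)\<close> words (\<open>card_sparse_words_ge\<close>). Conversely, weighting each word by
  \<open>(1 / g n) ^ k\<close>, where \<open>k\<close> counts its occurrences of \<open>True\<close>, bounds the number of words by
  \<open>exp ((n / g n) * (1 + ln (g n)))\<close> up to lower order terms (\<open>card_sparse_words_le\<close>); the factor
  \<open>1 + ln (g n)\<close> is absorbed by any power of \<open>g n\<close>.

  A factorial language \<open>W\<close> is turned into a Lie algebra as follows. The monomial algebra with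
  basis \<open>W\<close> is enlarged by one more letter \<open>z\<close> that may occur only as the first letter of a word, so
  that the basis is \<open>W \<union> z W\<close>; the Lie algebra is the one generated by the three letters under the
  commutator. A letter times a word starting with \<open>z\<close> is zero, whence \<open>[z w, b] = z w b\<close>: all of
  \<open>z W\<close> arises from left-normed commutators of letters, of the expected length. Hence the growth is
  between the number of words in \<open>W\<close> and twice this number, up to a shift of the length by one
  (\<open>lie_algebra_with_word_growth\<close>).
  Other generating subspaces only rescale the argument of the growth function
  (\<open>growth_generator_independent\<close>), which the asymptotic estimates tolerate.
\<close>

section \<open>Growth does not depend on the generating subspace\<close>

context lie_algebra
begin

text \<open>
  The subspace whose dimension is \<open>growth V n\<close>, written as the span of a single set of products,
  so that statements about it reduce to products and bilinearity.
\<close>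

definition filtration :: "'v set \<Rightarrow> nat \<Rightarrow> 'v set" where
  "filtration V n = span {x. \<exists>i\<le>n. lie_product V i x}"

lemma lie_product_pos: "lie_product V i x \<Longrightarrow> 1 \<le> i"
  by (induction rule: lie_product.induct) auto

lemma lie_product_in_carrier:
  assumes "V \<subseteq> L" "lie_product V i x" shows "x \<in> L"
  using assms(2,1) by (induction rule: lie_product.induct) (auto intro: bracket_closed)

lemma filtration_mono: "m \<le> n \<Longrightarrow> filtration V m \<subseteq> filtration V n"
  unfolding filtration_def by (rule span_mono) (use order_trans in blast)

lemma filtration_subset_carrier: "V \<subseteq> L \<Longrightarrow> filtration V n \<subseteq> L"
  unfolding filtration_def
  by (intro span_minimal subspace_carrier) (auto intro: lie_product_in_carrier)

lemma growth_eq_dim_filtration: "growth V n = dim (filtration V n)"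
proof -
  have "span (\<Union>i\<in>{1..n}. lie_power V i) = filtration V n"
  proof (rule antisym)
    show "span (\<Union>i\<in>{1..n}. lie_power V i) \<subseteq> filtration V n"
    proof (rule span_minimal)
      show "(\<Union>i\<in>{1..n}. lie_power V i) \<subseteq> filtration V n"
        unfolding lie_power_def filtration_def
        by (intro UN_least span_mono) auto
    qed (simp add: filtration_def)
    show "filtration V n \<subseteq> span (\<Union>i\<in>{1..n}. lie_power V i)"
      unfolding filtration_def lie_power_def
    proof (rule span_mono, rule subsetI)
      fix x assume "x \<in> {x. \<exists>i\<le>n. lie_product V i x}"
      then obtain i where "i \<le> n" "lie_product V i x" by blast
      then show "x \<in> (\<Union>i\<in>{1..n}. span {x. lie_product V i x})"
        by (intro UN_I[of i] span_base) (auto dest: lie_product_pos)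
    qed
  qed
  then show ?thesis by (simp add: growth_def)
qed

text \<open>
  Bilinearity of the bracket, valid on \<open>L\<close> only, in the form in which it is used: a bracket of two
  linear combinations is controlled by the brackets of the spanning elements.
\<close>

lemma bracket_span:
  assumes "S \<subseteq> L" "T \<subseteq> L"
    and R: "\<And>s t. s \<in> S \<Longrightarrow> t \<in> T \<Longrightarrow> bracket s t \<in> span R"
    and "x \<in> span S" "y \<in> span T"
  shows "bracket x y \<in> span R"
proof -
  have zero_right: "bracket s 0 = 0" if "s \<in> L" for s
    using bracket_scale_right[of s s 0] that by simp
  have zero_left: "bracket 0 s = 0" if "s \<in> L" for s
    using bracket_scale_left[of s s 0] that by simp
  have zero: "0 \<in> L" using subspace_0[OF subspace_carrier] .
  have y: "y \<in> L"
    using span_minimal[OF assms(2) subspace_carrier] assms(5) by blast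
  have right: "bracket s y \<in> span R" if s: "s \<in> S" for s
  proof -
    have "subspace {t \<in> L. bracket s t \<in> span R}"
      using s assms(1) subspace_carrier zero_right zero
      by (auto simp: subspace_def bracket_add_right bracket_scale_right subset_iff
          intro: span_add span_scale span_zero)
    then have "span T \<subseteq> {t \<in> L. bracket s t \<in> span R}"
      using assms(2) R[OF s] by (intro span_minimal) auto
    then show ?thesis using assms(5) by blast
  qed
  have "subspace {s \<in> L. bracket s y \<in> span R}"
    using y subspace_carrier zero_left zero
    by (auto simp: subspace_def bracket_add_left bracket_scale_left
        intro: span_add span_scale span_zero)
  then have "span S \<subseteq> {s \<in> L. bracket s y \<in> span R}"
    using assms(1) right by (intro span_minimal) auto
  then show ?thesis using assms(4) by blast
qed

lemma bracket_filtration: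
  assumes "V \<subseteq> L" "x \<in> filtration V m" "y \<in> filtration V n"
  shows "bracket x y \<in> filtration V (m + n)"
  using assms(2,3) unfolding filtration_def
proof (rule bracket_span[rotated 3])
  fix s t
  assume "s \<in> {x. \<exists>i\<le>m. lie_product V i x}" "t \<in> {x. \<exists>i\<le>n. lie_product V i x}"
  then obtain i j where "i \<le> m" "j \<le> n" "lie_product V i s" "lie_product V j t" by blast
  then show "bracket s t \<in> span {x. \<exists>i\<le>m + n. lie_product V i x}"
    by (intro span_base) (auto intro!: exI[of _ "i + j"] lie_product.product)
qed (auto intro: lie_product_in_carrier[OF assms(1)])

text \<open>
  A product of \<open>i\<close> factors, each a combination of products of length at most \<open>c\<close> in \<open>X\<close>, is a
  combination of products of length at most \<open>c * i\<close> in \<open>X\<close>.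
\<close>

lemma filtration_trans:
  assumes "X \<subseteq> L" "V \<subseteq> filtration X c"
  shows "filtration V n \<subseteq> filtration X (c * n)"
proof -
  have "x \<in> filtration X (c * i)" if "lie_product V i x" for i x
    using that
  proof (induction rule: lie_product.induct)
    case (generator v)
    then show ?case using assms(2) by auto
  next
    case (product i x j y)
    then show ?case
      using bracket_filtration[OF assms(1)] by (simp add: distrib_left)
  qed
  then have "{x. \<exists>i\<le>n. lie_product V i x} \<subseteq> filtration X (c * n)"
    using filtration_mono[of "c * _" "c * n" X] by fastforce
  then show ?thesis
    unfolding filtration_def[of V] by (rule span_minimal) (simp add: filtration_def)
qed

text \<open>
  The union of the filtration is itself a subalgebra containing \<open>V\<close>. Consequently every finite
  part of the algebra already appears at a finite stage.
\<close>

lemma filtration_exhausts: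
  assumes "V \<subseteq> L" "lie_subalgebra hull V = L"
  shows "L = (\<Union>n. filtration V n)"
proof
  have mono: "x \<in> filtration V (m + n)" "x \<in> filtration V (n + m)"
    if "x \<in> filtration V m" for x m n
    using that filtration_mono[of m "m + n" V] filtration_mono[of m "n + m" V] by auto
  have "lie_subalgebra (\<Union>n. filtration V n)"
    unfolding lie_subalgebra_def
  proof (intro conjI)
    show "subspace (\<Union>n. filtration V n)"
      unfolding subspace_def
    proof (intro conjI ballI allI)
      show "0 \<in> (\<Union>n. filtration V n)" by (auto simp: filtration_def intro: span_zero)
    next
      fix x y assume "x \<in> (\<Union>n. filtration V n)" "y \<in> (\<Union>n. filtration V n)"
      then obtain m n where "x \<in> filtration V m" "y \<in> filtration V n" by blast
      then have "x \<in> filtration V (m + n)" "y \<in> filtration V (m + n)" using mono by auto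
      then have "x + y \<in> filtration V (m + n)" unfolding filtration_def by (rule span_add)
      then show "x + y \<in> (\<Union>n. filtration V n)" by blast
    next
      fix c x assume "x \<in> (\<Union>n. filtration V n)"
      then show "scale c x \<in> (\<Union>n. filtration V n)"
        by (auto simp: filtration_def intro: span_scale)
    qed
    show "(\<Union>n. filtration V n) \<subseteq> L" using filtration_subset_carrier[OF assms(1)] by blast
    show "\<forall>x\<in>\<Union>n. filtration V n. \<forall>y\<in>\<Union>n. filtration V n. bracket x y \<in> (\<Union>n. filtration V n)"
      using bracket_filtration[OF assms(1)] by blast
  qed
  moreover have "V \<subseteq> filtration V 1"
    unfolding filtration_def
    by (auto intro!: span_base exI[of _ "1::nat"] lie_product.generator[simplified])
  ultimately show "L \<subseteq> (\<Union>n. filtration V n)"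
    using hull_minimal[of V "\<Union>n. filtration V n" lie_subalgebra] assms(2) by blast
qed (use filtration_subset_carrier[OF assms(1)] in blast)

lemma finite_subset_filtration:
  assumes "V \<subseteq> L" "lie_subalgebra hull V = L" "finite B" "B \<subseteq> L"
  obtains n where "B \<subseteq> filtration V n"
proof -
  have "\<exists>n. B \<subseteq> filtration V n"
    using assms(3,4)
  proof (induction B rule: finite_induct)
    case (insert x B)
    then obtain n where n: "B \<subseteq> filtration V n" by auto
    obtain m where "x \<in> filtration V m"
      using insert.prems filtration_exhausts[OF assms(1,2)] by blast
    then have "insert x B \<subseteq> filtration V (max m n)"
      using n filtration_mono[of m "max m n" V] filtration_mono[of n "max m n" V] by auto
    then show ?case ..
  qed auto
  then show thesis using that by blast
qed

text \<open>
  Monotonicity of \<open>dim\<close> needs a finite spanning set on top, because \<open>dim\<close> is \<open>0\<close> on subspaces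
  of infinite dimension.
\<close>

lemma dim_mono_finitely_spanned:
  assumes "S \<subseteq> T" "T \<subseteq> span W" "finite W"
  shows "dim S \<le> dim T"
proof -
  obtain B where B: "B \<subseteq> T" "independent B" "T \<subseteq> span B" "card B = dim T"
    using basis_exists[of T] by metis
  have "finite B" using independent_span_bound[OF assms(3) B(2)] B(1) assms(2) by blast
  then show ?thesis using dim_le_card[of S B] B assms(1) by auto
qed

text \<open>
  Each of \<open>X\<close> and \<open>V\<close> lies in a finite stage of the filtration of the other, and
  \<open>filtration_trans\<close> compares all stages. The second bound is phrased for all sufficiently large
  arguments rather than only for multiples of \<open>c\<close>, since it is needed at every \<open>n\<close>.
\<close>

lemma growth_generator_independent:
  assumes "finite X" "X \<subseteq> L" "lie_subalgebra hull X = L"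
    and fin: "\<And>n. \<exists>W. finite W \<and> filtration X n \<subseteq> span W"
    and V: "fin_dim_generating_subspace V"
  obtains c where "c \<ge> 1"
    "\<And>n. growth V n \<le> growth X (c * n)"
    "\<And>m n. c * m \<le> n \<Longrightarrow> growth X m \<le> growth V n"
proof -
  obtain B where B: "finite B" "span B = V" and V': "V \<subseteq> L" "lie_subalgebra hull V = L"
    using V by (auto simp: fin_dim_generating_subspace_def)
  have "B \<subseteq> L" using B(2) V'(1) span_superset[of B] by blast
  then obtain a where "B \<subseteq> filtration X a"
    using finite_subset_filtration[OF assms(2,3) B(1)] by blast
  then have "V \<subseteq> filtration X a"
    unfolding B(2)[symmetric] by (intro span_minimal) (auto simp: filtration_def)
  obtain b where b: "X \<subseteq> filtration V b"
    using finite_subset_filtration[OF V' assms(1,2)] by blast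
  define c where "c = Suc (max a b)"
  have "a \<le> c" "b \<le> c" by (auto simp: c_def)
  then have Vc: "V \<subseteq> filtration X c" and Xc: "X \<subseteq> filtration V c"
    using \<open>V \<subseteq> filtration X a\<close> b filtration_mono[of a c X] filtration_mono[of b c V] by blast+
  have "growth V n \<le> growth X (c * n)" for n
    using fin[of "c * n"] filtration_trans[OF assms(2) Vc, of n]
    unfolding growth_eq_dim_filtration by (blast intro: dim_mono_finitely_spanned)
  moreover have "growth X m \<le> growth V n" if "c * m \<le> n" for m n
  proof -
    obtain W where "finite W" "filtration X (c * n) \<subseteq> span W" using fin by blast
    moreover have "filtration V n \<subseteq> filtration X (c * n)"
      by (rule filtration_trans[OF assms(2) Vc])
    moreover have "filtration X m \<subseteq> filtration V n"
      using filtration_trans[OF V'(1) Xc, of m] filtration_mono[OF that, of V] by simp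
    ultimately show ?thesis
      unfolding growth_eq_dim_filtration by (meson dim_mono_finitely_spanned subset_trans)
  qed
  moreover have "c \<ge> 1" by (simp add: c_def)
  ultimately show thesis using that by blast
qed

text \<open>
  A subset generates a Lie algebra in its own right. The third part says that generation inside
  the hull is the same as generation inside the ambient algebra.
\<close>

lemma lie_algebra_hull:
  assumes "X \<subseteq> L"
  shows "lie_algebra scale (lie_subalgebra hull X) bracket"
    and "X \<subseteq> lie_subalgebra hull X"
    and "lie_algebra.lie_subalgebra scale (lie_subalgebra hull X) bracket hull X
         = lie_subalgebra hull X"
proof -
  let ?H = "lie_subalgebra hull X"
  have L: "lie_subalgebra L"
    using subspace_carrier bracket_closed by (auto simp: lie_subalgebra_def)
  have "lie_subalgebra (\<Inter>A)" if "\<forall>S\<in>A. lie_subalgebra S" "L \<in> A" for A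
  proof -
    have "subspace (\<Inter>A)" using that(1) by (auto simp: lie_subalgebra_def intro: subspace_Inter)
    moreover have "\<forall>x\<in>\<Inter>A. \<forall>y\<in>\<Inter>A. bracket x y \<in> \<Inter>A"
      using that(1) unfolding lie_subalgebra_def by blast
    ultimately show ?thesis using that(2) by (auto simp: lie_subalgebra_def)
  qed
  from this[of "{S. lie_subalgebra S \<and> X \<subseteq> S}"] have H: "lie_subalgebra ?H"
    unfolding hull_def using L assms by simp
  then have sub: "?H \<subseteq> L" and "subspace ?H"
    and closed: "\<And>x y. x \<in> ?H \<Longrightarrow> y \<in> ?H \<Longrightarrow> bracket x y \<in> ?H"
    by (auto simp: lie_subalgebra_def)
  then show lie: "lie_algebra scale ?H bracket"
    by unfold_locales
      (auto simp: bracket_add_left bracket_add_right bracket_scale_left bracket_scale_right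
        bracket_self jacobi subset_iff)
  show X: "X \<subseteq> ?H" by (rule hull_subset)
  have eq: "lie_algebra.lie_subalgebra scale ?H bracket S \<longleftrightarrow> lie_subalgebra S \<and> S \<subseteq> ?H" for S
    using sub unfolding lie_algebra.lie_subalgebra_def[OF lie] lie_subalgebra_def by blast
  show "lie_algebra.lie_subalgebra scale ?H bracket hull X = ?H"
  proof (rule hull_unique[OF X])
    show "lie_algebra.lie_subalgebra scale ?H bracket ?H" using H eq by blast
    fix S assume "X \<subseteq> S" "lie_algebra.lie_subalgebra scale ?H bracket S"
    then show "?H \<subseteq> S" using eq by (simp add: hull_minimal)
  qed
qed

end

section \<open>Words with few occurrences of one letter\<close>

definition factorial_language :: "'a list set \<Rightarrow> bool" where
  "factorial_language W \<longleftrightarrow> (\<forall>u w. w \<in> W \<longrightarrow> sublist u w \<longrightarrow> u \<in> W)"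

definition words_upto :: "bool list set \<Rightarrow> nat \<Rightarrow> bool list set" where
  "words_upto W n = {w \<in> W. length w \<le> n}"

lemma finite_words_upto: "finite (words_upto W n)"
  by (rule finite_subset[OF _ finite_lists_length_le[of "UNIV :: bool set" n]])
    (auto simp: words_upto_def)

text \<open>
  A quota on \<open>True\<close> is imposed on all factors, not only on the word itself, to make the language
  factorial. The summand \<open>1\<close> admits the one-letter words.
\<close>

definition sparse_language :: "(nat \<Rightarrow> real) \<Rightarrow> bool list set" where
  "sparse_language g =
    {w. \<forall>u. sublist u w \<longrightarrow> real (count_list u True) \<le> real (length u) / g (length u) + 1}"

lemma factorial_sparse_language: "factorial_language (sparse_language g)"
  unfolding factorial_language_def sparse_language_def
  by (auto intro: sublist_order.order_trans)

lemma singleton_in_sparse_language: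
  assumes "\<And>n. g n \<ge> 1"
  shows "[b] \<in> sparse_language g"
proof -
  have "real (count_list u True) \<le> real (length u) / g (length u) + 1" if "sublist u [b]" for u
  proof -
    have "count_list u True \<le> length u" by (rule count_le_length)
    also have "\<dots> \<le> 1" using sublist_length_le[OF that] by simp
    finally have "real (count_list u True) \<le> 1" by simp
    moreover have "0 \<le> real (length u) / g (length u)"
      using assms[of "length u"] by (intro divide_nonneg_nonneg) auto
    ultimately show ?thesis by linarith
  qed
  then show ?thesis by (simp add: sparse_language_def)
qed

text \<open>
  The weighted count of words factorises over the positions; it replaces any estimate of binomial
  coefficients.
\<close>

lemma sum_weight_bool_lists:
  fixes x :: "'a :: comm_semiring_1"
  shows "(\<Sum>w | length w = n. x ^ count_list w True) = (1 + x) ^ n"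
proof (induction n)
  case (Suc n)
  let ?A = "{w :: bool list. length w = n}"
  have fin: "finite ?A" using finite_lists_length_eq[of "UNIV :: bool set" n] by simp
  have "{w. length w = Suc n} = Cons True ` ?A \<union> Cons False ` ?A"
  proof (rule set_eqI)
    fix w :: "bool list"
    show "w \<in> {w. length w = Suc n} \<longleftrightarrow> w \<in> Cons True ` ?A \<union> Cons False ` ?A"
      by (cases w; cases "hd w") auto
  qed
  then have "(\<Sum>w | length w = Suc n. x ^ count_list w True)
      = (\<Sum>w\<in>Cons True ` ?A \<union> Cons False ` ?A. x ^ count_list w True)"
    by simp
  also have "\<dots> = (\<Sum>w\<in>Cons True ` ?A. x ^ count_list w True) +
        (\<Sum>w\<in>Cons False ` ?A. x ^ count_list w True)"
    using fin by (intro sum.union_disjoint) auto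
  also have "\<dots> = (1 + x) * (\<Sum>w\<in>?A. x ^ count_list w True)"
    by (simp add: sum.reindex sum_distrib_left algebra_simps sum.distrib)
  finally show ?case using Suc by simp
qed simp

text \<open>
  Every sparse word \<open>w\<close> of length at most \<open>n\<close> has at most \<open>n / g n + 1\<close> occurrences of \<open>True\<close> (here
  the monotonicity of \<open>n / g n\<close> enters), so the weight \<open>(1 / g n) ^ count_list w True\<close> is at least
  \<open>g n powr - (n / g n + 1)\<close>. The total weight of the words of one length \<open>k \<le> n\<close> is at most
  \<open>(1 + 1 / g n) ^ n \<le> exp (n / g n)\<close>, and there are \<open>n + 1\<close> lengths.
\<close>

lemma card_sparse_words_le:
  assumes g1: "\<And>n. g n \<ge> 1" and mono: "mono (\<lambda>n. real n / g n)"
  shows "real (card (words_upto (sparse_language g) n))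
    \<le> (real n + 1) * g n powr (real n / g n + 1) * exp (real n / g n)"
proof -
  let ?S = "sparse_language g" and ?K = "real n / g n + 1" and ?x = "1 / g n"
  have x: "0 < ?x" "?x \<le> 1" using g1[of n] by auto
  have weight: "1 \<le> g n powr ?K * ?x ^ count_list w True" if "w \<in> ?S" "length w \<le> n" for w
  proof -
    have "real (count_list w True) \<le> real (length w) / g (length w) + 1"
      using that(1) by (auto simp: sparse_language_def)
    also have "\<dots> \<le> ?K" using monoD[OF mono that(2)] by simp
    finally have "g n powr (real (count_list w True)) \<le> g n powr ?K"
      using g1[of n] by (intro powr_mono) auto
    then have "g n ^ count_list w True \<le> g n powr ?K"
      using g1[of n] by (simp add: powr_realpow)
    then show ?thesis using g1[of n] by (simp add: power_one_over field_simps)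
  qed
  have level: "(\<Sum>w | w \<in> ?S \<and> length w = k. 1) \<le> g n powr ?K * exp (real n / g n)"
    if "k \<le> n" for k
  proof -
    have fin: "finite {w :: bool list. length w = k}"
      using finite_lists_length_eq[of "UNIV :: bool set" k] by simp
    have "(\<Sum>w | w \<in> ?S \<and> length w = k. 1)
        \<le> (\<Sum>w | w \<in> ?S \<and> length w = k. g n powr ?K * ?x ^ count_list w True)"
      using weight that by (intro sum_mono) auto
    also have "\<dots> \<le> (\<Sum>w | length w = k. g n powr ?K * ?x ^ count_list w True)"
      using fin x by (intro sum_mono2) auto
    also have "\<dots> = g n powr ?K * (1 + ?x) ^ k"
      by (simp only: sum_distrib_left[symmetric] sum_weight_bool_lists)
    also have "(1 + ?x) ^ k \<le> (1 + ?x) ^ n"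
      using that x by (intro power_increasing) auto
    also have "(1 + ?x) ^ n \<le> exp ?x ^ n"
      using x by (intro power_mono exp_ge_add_one_self) auto
    also have "exp ?x ^ n = exp (real n / g n)" by (simp add: exp_of_nat_mult[symmetric])
    finally show ?thesis using g1[of n] by (simp add: mult_left_mono)
  qed
  have "real (card (words_upto ?S n)) = (\<Sum>w\<in>words_upto ?S n. 1)" by simp
  also have "\<dots> = (\<Sum>w\<in>(\<Union>k\<in>{..n}. {w \<in> ?S. length w = k}). 1)"
    by (intro sum.cong) (auto simp: words_upto_def)
  also have "(\<Sum>w\<in>(\<Union>k\<in>{..n}. {w \<in> ?S. length w = k}). (1::real))
      = (\<Sum>k\<le>n. \<Sum>w | w \<in> ?S \<and> length w = k. 1)"
  proof (rule sum.UNION_disjoint)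
    show "\<forall>k\<in>{..n}. finite {w \<in> ?S. length w = k}"
      by (intro ballI finite_subset[OF _ finite_words_upto[of ?S n]]) (auto simp: words_upto_def)
  qed auto
  also have "\<dots> \<le> (\<Sum>k\<le>n. g n powr ?K * exp (real n / g n))"
    using level by (intro sum_mono) auto
  finally show ?thesis by (simp add: algebra_simps)
qed

text \<open>
  The letters of \<open>bs\<close> are placed at the multiples of \<open>d\<close>, with \<open>False\<close> everywhere else.
\<close>

definition spread :: "nat \<Rightarrow> bool list \<Rightarrow> bool list" where
  "spread d bs = concat (map (\<lambda>b. b # replicate (d - 1) False) bs)"

lemma length_spread: "d \<ge> 1 \<Longrightarrow> length (spread d bs) = d * length bs"
  by (induction bs) (auto simp: spread_def algebra_simps)

lemma spread_nth:
  assumes "d \<ge> 1" "i < length (spread d bs)" "spread d bs ! i"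
  shows "d dvd i"
  using assms(2,3)
proof (induction bs arbitrary: i)
  case (Cons b bs)
  have eq: "spread d (b # bs) = (b # replicate (d - 1) False) @ spread d bs"
    by (simp add: spread_def)
  show ?case
  proof (cases "i < d")
    case True
    then have "i = 0"
      using Cons.prems unfolding eq nth_append by (cases i) (auto split: if_splits)
    then show ?thesis by simp
  next
    case False
    then have "d dvd i - d"
      using Cons.prems assms(1) unfolding eq nth_append by (intro Cons.IH) auto
    then show ?thesis using False by (simp add: dvd_minus_self)
  qed
qed (simp add: spread_def)

lemma inj_spread: "inj (spread d)"
proof (rule injI)
  fix bs cs show "spread d bs = spread d cs \<Longrightarrow> bs = cs"
    by (induction bs arbitrary: cs; case_tac cs) (auto simp: spread_def)
qed

text \<open>
  Distinct multiples of \<open>d\<close> have distinct quotients by \<open>d\<close>; counted downwards from the largest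
  possible quotient \<open>b\<close>, these lie in \<open>{..m div d}\<close>.
\<close>

lemma card_multiples_interval:
  fixes d m j :: nat
  assumes "d \<ge> 1"
  shows "card {i. i < m \<and> d dvd (j + i)} \<le> m div d + 1"
proof (cases "m = 0")
  case False
  let ?A = "{i. i < m \<and> d dvd (j + i)}"
  define b where "b = (j + m - 1) div d"
  have "inj_on (\<lambda>i. b - (j + i) div d) ?A"
  proof (rule inj_onI)
    fix i k assume ik: "i \<in> ?A" "k \<in> ?A" "b - (j + i) div d = b - (j + k) div d"
    have "(j + i) div d \<le> b" "(j + k) div d \<le> b"
      using ik unfolding b_def by (auto intro!: div_le_mono)
    then have "(j + i) div d = (j + k) div d" using ik(3) by linarith
    then show "i = k" using ik(1,2) by (auto elim!: dvdE)
      (metis add_left_cancel assms not_one_le_zero nonzero_mult_div_cancel_left)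
  qed
  moreover have "(\<lambda>i. b - (j + i) div d) ` ?A \<subseteq> {..m div d}"
  proof (rule image_subsetI)
    fix i assume "i \<in> ?A"
    then have i: "i < m" "d dvd j + i" by auto
    then obtain t where t: "j + i = d * t" by (auto elim: dvdE)
    have "b = (d * t + (m - 1 - i)) div d" using i(1) t unfolding b_def
      by (intro arg_cong[of _ _ "\<lambda>x. x div d"]) linarith
    also have "\<dots> = t + (m - 1 - i) div d" using assms by simp
    also have "\<dots> \<le> t + m div d" by (intro add_left_mono div_le_mono) simp
    finally show "b - (j + i) div d \<in> {..m div d}" using t assms by simp
  qed
  ultimately show ?thesis using card_inj_on_le[of _ ?A "{..m div d}"] by simp
qed simp

text \<open>
  A factor of length \<open>m \<le> n\<close> meets at most \<open>m / d + 1\<close> multiples of \<open>d\<close>, and \<open>g m \<le> g n \<le> d\<close>. So one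
  spacing that is legal at length \<open>n\<close> satisfies the quota at all smaller scales.
\<close>

lemma spread_in_sparse_language:
  assumes g1: "\<And>n. g n \<ge> 1" and mono: "mono g"
    and d: "g n \<le> real d" and len: "length (spread d bs) \<le> n"
  shows "spread d bs \<in> sparse_language g"
proof -
  have d1: "d \<ge> 1" using g1[of n] d by linarith
  have "real (count_list u True) \<le> real (length u) / g (length u) + 1"
    if sub: "sublist u (spread d bs)" for u
  proof -
    obtain p s where ps: "spread d bs = p @ u @ s" using sub by (auto simp: sublist_def)
    have "count_list u True = card {i. i < length u \<and> u ! i}"
      by (simp add: count_list_eq_length_filter length_filter_conv_card)
    also have "\<dots> \<le> card {i. i < length u \<and> d dvd (length p + i)}"
    proof (rule card_mono)
      show "{i. i < length u \<and> u ! i} \<subseteq> {i. i < length u \<and> d dvd (length p + i)}"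
        using spread_nth[OF d1, of "length p + _" bs] unfolding ps by (auto simp: nth_append)
    qed simp
    also have "\<dots> \<le> length u div d + 1" by (rule card_multiples_interval[OF d1])
    finally have "real (count_list u True) \<le> real (length u div d) + 1" by linarith
    also have "real (length u div d) \<le> real (length u) / real d" by (rule of_nat_div_le_of_nat)
    also have "\<dots> \<le> real (length u) / g (length u)"
    proof (rule divide_left_mono)
      have "length u \<le> n" using sublist_length_le[OF sub] len by simp
      then show "g (length u) \<le> real d" using monoD[OF mono, of "length u" n] d by linarith
      show "0 < real d * g (length u)" using d1 g1[of "length u"] by simp
    qed simp
    finally show ?thesis by simp
  qed
  then show ?thesis by (simp add: sparse_language_def)
qed

lemma card_sparse_words_ge:
  assumes g1: "\<And>n. g n \<ge> 1" and mono: "mono g" and d: "g n \<le> real d"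
  shows "2 ^ (n div d) \<le> card (words_upto (sparse_language g) n)"
proof -
  let ?A = "{bs :: bool list. length bs = n div d}"
  have d1: "d \<ge> 1" using g1[of n] d by linarith
  have "2 ^ (n div d) = card ?A"
    using card_lists_length_eq[of "UNIV :: bool set" "n div d"] by simp
  also have "\<dots> = card (spread d ` ?A)"
    using inj_spread by (intro card_image[symmetric]) (auto intro: inj_on_subset)
  also have "\<dots> \<le> card (words_upto (sparse_language g) n)"
  proof (rule card_mono[OF finite_words_upto])
    have "length (spread d bs) \<le> n" if "length bs = n div d" for bs
      using that length_spread[OF d1, of bs] by simp
    then show "spread d ` ?A \<subseteq> words_upto (sparse_language g) n"
      using spread_in_sparse_language[OF g1 mono d] by (auto simp: words_upto_def)
  qed
  finally show ?thesis .
qed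

section \<open>The Lie algebra of a factorial language\<close>

text \<open>
  The bilinear product with structure constants \<open>monom 1 i * monom 1 j = m i j\<close>; polynomials serve
  only as finitely supported coefficient sequences.
\<close>

definition bilinear_extension ::
  "(nat \<Rightarrow> nat \<Rightarrow> 'f::field poly) \<Rightarrow> 'f poly \<Rightarrow> 'f poly \<Rightarrow> 'f poly" where
  "bilinear_extension m p q =
    (\<Sum>i\<le>degree p. \<Sum>j\<le>degree q. smult (coeff p i * coeff q j) (m i j))"

text \<open>
  With independent upper summation bounds, two arguments can be brought to a common range before
  their coefficients are added.
\<close>

lemma bilinear_extension_eq:
  assumes "degree p \<le> a" "degree q \<le> b"
  shows "bilinear_extension m p q =
    (\<Sum>i\<le>a. \<Sum>j\<le>b. smult (coeff p i * coeff q j) (m i j))"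
proof -
  have "(\<Sum>i\<le>a. \<Sum>j\<le>b. smult (coeff p i * coeff q j) (m i j))
      = (\<Sum>i\<le>a. \<Sum>j\<le>degree q. smult (coeff p i * coeff q j) (m i j))"
    using assms(2) by (intro sum.cong refl sum.mono_neutral_right) (auto simp: coeff_eq_0)
  also have "\<dots> = bilinear_extension m p q"
    unfolding bilinear_extension_def
    using assms(1) by (intro sum.mono_neutral_right) (auto simp: coeff_eq_0)
  finally show ?thesis by simp
qed

lemma bilinear_extension_add_left:
  "bilinear_extension m (p + p') q = bilinear_extension m p q + bilinear_extension m p' q"
proof -
  define a where "a = max (degree p) (degree p')"
  have "degree p \<le> a" "degree p' \<le> a" "degree (p + p') \<le> a"
    by (auto simp: a_def degree_add_le_max)
  then show ?thesis
    by (simp add: bilinear_extension_eq[of _ a _ "degree q"] algebra_simps smult_add_left sum.distrib)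
qed

lemma bilinear_extension_add_right:
  "bilinear_extension m p (q + q') = bilinear_extension m p q + bilinear_extension m p q'"
proof -
  define b where "b = max (degree q) (degree q')"
  have "degree q \<le> b" "degree q' \<le> b" "degree (q + q') \<le> b"
    by (auto simp: b_def degree_add_le_max)
  then show ?thesis
    by (simp add: bilinear_extension_eq[of _ "degree p" _ b] algebra_simps smult_add_left sum.distrib)
qed

lemma smult_sum_right: "smult c (sum f A) = (\<Sum>x\<in>A. smult c (f x))"
  by (induction A rule: infinite_finite_induct) (auto simp: smult_add_right)

lemma bilinear_extension_smult_left:
  "bilinear_extension m (smult c p) q = smult c (bilinear_extension m p q)"
  by (simp add: bilinear_extension_eq[of _ "degree p" _ "degree q"] degree_smult_le
      smult_sum_right mult.assoc)

lemma bilinear_extension_smult_right: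
  "bilinear_extension m p (smult c q) = smult c (bilinear_extension m p q)"
  by (simp add: bilinear_extension_eq[of _ "degree p" _ "degree q"] degree_smult_le
      smult_sum_right mult_ac)

lemma bilinear_extension_monom:
  "bilinear_extension m (monom 1 i) (monom 1 j) = m i j"
proof -
  have "bilinear_extension m (monom 1 i) (monom 1 j) =
      (\<Sum>k\<le>i. \<Sum>l\<le>j. if k = i \<and> l = j then m i j else 0)"
    unfolding bilinear_extension_eq[OF degree_monom_le degree_monom_le]
    by (intro sum.cong refl) auto
  also have "\<dots> = (\<Sum>k\<le>i. if k = i then \<Sum>l\<le>j. if l = j then m i j else 0 else 0)"
    by (intro sum.cong refl) auto
  also have "\<dots> = m i j" by simp
  finally show ?thesis .
qed

lemma poly_linear_induct [case_names add smult monom]: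
  assumes "\<And>p q. P p \<Longrightarrow> P q \<Longrightarrow> P (p + q)"
    and "\<And>c p. P p \<Longrightarrow> P (smult c p)"
    and "\<And>i. P (monom 1 i)"
  shows "P (p :: 'f::field poly)"
proof -
  have monom: "P (monom c i)" for c i
    using assms(2)[OF assms(3), of c i] by (simp add: smult_monom)
  have "P (\<Sum>i\<in>A. monom (coeff p i) i)" for A
    using monom[of 0 0]
    by (induction A rule: infinite_finite_induct) (auto intro: assms(1) monom)
  then show ?thesis using poly_as_sum_of_monoms[of p] by metis
qed

text \<open>
  Both sides are linear in each argument, so the identity needs to be known on monomials only.
\<close>

lemma bilinear_extension_assoc:
  assumes "\<And>i j k. bilinear_extension m (m i j) (monom 1 k)
                  = bilinear_extension m (monom 1 i) (m j k)"
  shows "bilinear_extension m (bilinear_extension m p q) r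
       = bilinear_extension m p (bilinear_extension m q r)"
proof (induction p rule: poly_linear_induct)
  case (monom i)
  show ?case
  proof (induction q rule: poly_linear_induct)
    case (monom j)
    show ?case
      by (induction r rule: poly_linear_induct)
        (simp_all add: bilinear_extension_add_right bilinear_extension_smult_right
          bilinear_extension_monom assms)
  qed (simp_all add: bilinear_extension_add_left bilinear_extension_add_right
      bilinear_extension_smult_left bilinear_extension_smult_right)
qed (simp_all add: bilinear_extension_add_left bilinear_extension_smult_left)

lemma vector_space_smult: "vector_space (smult :: 'f::field \<Rightarrow> _)"
  by unfold_locales (auto simp: smult_add_right smult_add_left)

lemma lie_algebra_commutator:
  fixes m :: "nat \<Rightarrow> nat \<Rightarrow> 'f::field poly"
  defines "mul \<equiv> bilinear_extension m"
  assumes assoc: "\<And>p q r. mul (mul p q) r = mul p (mul q r)"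
  shows "lie_algebra smult UNIV (\<lambda>p q. mul p q - mul q p)"
proof -
  interpret vector_space "smult :: 'f \<Rightarrow> _" by (rule vector_space_smult)
  have minus: "mul (p - q) r = mul p r - mul q r" "mul r (p - q) = mul r p - mul r q" for p q r
    using bilinear_extension_add_left[of m p "smult (-1) q" r]
      bilinear_extension_add_right[of m r p "smult (-1) q"]
    unfolding mul_def bilinear_extension_smult_left bilinear_extension_smult_right by simp_all
  show ?thesis
  proof unfold_locales
    show "subspace (UNIV :: 'f poly set)" by (rule subspace_UNIV)
  qed (simp_all add: mul_def[symmetric] minus assoc smult_diff_right
      bilinear_extension_add_left[where m = m, folded mul_def]
      bilinear_extension_add_right[where m = m, folded mul_def]
      bilinear_extension_smult_left[where m = m, folded mul_def]
      bilinear_extension_smult_right[where m = m, folded mul_def])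
qed

text \<open>
  The index \<open>to_nat (s, w)\<close> stands for the word \<open>w\<close> if \<open>s\<close> is false and for \<open>z w\<close> if \<open>s\<close> is true.
  Concatenation gives zero if it leaves the language or if \<open>z\<close> would occur in a later position.
  Indices that are not of the form \<open>to_nat (s, w)\<close> are decoded as well; this keeps the product
  associative on all polynomials, so that no carrier has to be carved out first.
\<close>

definition word_mult :: "bool list set \<Rightarrow> nat \<Rightarrow> nat \<Rightarrow> 'f::field poly" where
  "word_mult W i j =
    (case (from_nat i, from_nat j) of ((s, u), (t, v)) \<Rightarrow>
       if t \<or> u @ v \<notin> W then 0 else monom 1 (to_nat (s :: bool, u @ v)))"

definition word_monom :: "bool \<Rightarrow> bool list \<Rightarrow> 'f::field poly" where
  "word_monom s w = monom 1 (to_nat (s, w))"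

definition commutator :: "bool list set \<Rightarrow> 'f::field poly \<Rightarrow> 'f poly \<Rightarrow> 'f poly" where
  "commutator W p q =
    bilinear_extension (word_mult W) p q - bilinear_extension (word_mult W) q p"

lemma mult_word_monom:
  "bilinear_extension (word_mult W) (word_monom s u) (word_monom t v) =
    (if t \<or> u @ v \<notin> W then 0 else word_monom s (u @ v))"
  by (simp add: word_monom_def bilinear_extension_monom word_mult_def)

text \<open>
  Either way of bracketing three words gives zero unless their full concatenation is in \<open>W\<close>:
  the partial concatenations are factors of it.
\<close>

lemma word_mult_assoc:
  assumes "factorial_language W"
  shows "bilinear_extension (word_mult W) (word_mult W i j) (monom 1 k :: 'f::field poly)
       = bilinear_extension (word_mult W) (monom 1 i) (word_mult W j k)"
proof -
  obtain s u t v r x where ijk: "from_nat i = (s :: bool, u :: bool list)"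
    "from_nat j = (t :: bool, v :: bool list)" "from_nat k = (r :: bool, x :: bool list)"
    by (metis surj_pair)
  have zero: "bilinear_extension m 0 p = 0" "bilinear_extension m p 0 = 0"
    for m and p :: "'f poly"
    using bilinear_extension_smult_left[of m 0 0 p] bilinear_extension_smult_right[of m p 0 0]
    by simp_all
  have "u @ v \<in> W" "v @ x \<in> W" if "u @ v @ x \<in> W"
    using that assms unfolding factorial_language_def
    by (metis append_assoc sublist_append_rightI, metis sublist_append_leftI)
  then show ?thesis
    by (auto simp: word_mult_def ijk zero bilinear_extension_monom)
qed

lemma lie_algebra_commutator_words:
  assumes "factorial_language W"
  shows "lie_algebra smult UNIV (commutator W :: 'f::field poly \<Rightarrow> _)"
  using lie_algebra_commutator[OF bilinear_extension_assoc[OF word_mult_assoc[OF assms]]]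
  by (simp add: commutator_def[abs_def])

lemma word_monom_eq_iff: "word_monom s u = (word_monom t v :: 'f::field poly) \<longleftrightarrow> s = t \<and> u = v"
  by (auto simp: word_monom_def monom_eq_iff')

lemma independent_monom_1:
  "\<not> module.dependent smult (range (monom (1 :: 'f::field)))"
proof -
  interpret vector_space "smult :: 'f \<Rightarrow> _" by (rule vector_space_smult)
  show ?thesis
    unfolding independent_explicit_finite_subsets
  proof (intro allI impI ballI)
    fix S u v
    assume S: "S \<subseteq> range (monom (1 :: 'f))" "finite S"
      and sum: "(\<Sum>v\<in>S. smult (u v) v) = 0" and v: "v \<in> S"
    obtain i where i: "v = monom 1 i" using S(1) v by auto
    have "0 = coeff (\<Sum>v\<in>S. smult (u v) v) i" by (simp add: sum)
    also have "\<dots> = (\<Sum>w\<in>S. u w * coeff w i)" by (simp add: coeff_sum)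
    also have "\<dots> = (\<Sum>w\<in>S. if w = v then u v else 0)"
      using S(1) i by (intro sum.cong refl) (auto split: if_splits)
    also have "\<dots> = u v" using S(2) v by simp
    finally show "u v = 0" by simp
  qed
qed

definition generators :: "'f::field poly set" where
  "generators = {word_monom False [True], word_monom False [False], word_monom True []}"

lemma word_monoms_eq_image:
  "{word_monom s w | s w. w \<in> words_upto W n} = case_prod word_monom ` (UNIV \<times> words_upto W n)"
  by auto

context
  fixes W :: "bool list set" and L :: "'f::field poly set"
  assumes W: "factorial_language W" and letters: "\<And>b. [b] \<in> W"
    and L: "lie_algebra smult L (commutator W)"
begin

interpretation lie_algebra smult L "commutator W" by (rule L)

text \<open>
  For \<open>w\<close> extended by a letter \<open>b\<close>, the commutator \<open>[z w, b]\<close> is \<open>z w b\<close>, since \<open>b z w = 0\<close>.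
\<close>

lemma marked_word_is_lie_product:
  "w \<in> W \<Longrightarrow> lie_product generators (length w + 1) (word_monom True w)"
proof (induction w rule: rev_induct)
  case Nil
  show ?case using lie_product.generator[of "word_monom True []" generators]
    by (simp add: generators_def)
next
  case (snoc b w)
  have "w \<in> W" using snoc.prems W unfolding factorial_language_def by blast
  then have "lie_product generators (length w + 1) (word_monom True w)" by (rule snoc.IH)
  moreover have "lie_product generators 1 (word_monom False [b])"
    by (rule lie_product.generator) (cases b; simp add: generators_def)
  ultimately have "lie_product generators (length w + 1 + 1)
      (commutator W (word_monom True w) (word_monom False [b]))"
    by (rule lie_product.product)
  moreover have "commutator W (word_monom True w) (word_monom False [b])
      = (word_monom True (w @ [b]) :: 'f poly)"
    using snoc.prems by (simp add: commutator_def mult_word_monom)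
  ultimately show ?case by simp
qed

text \<open>
  The marker \<open>z\<close> does not contribute to the length of a word, hence the inequality
  \<open>length w \<le> i\<close>.
\<close>

lemma lie_product_in_span_words:
  assumes "lie_product generators i p"
  shows "p \<in> span {word_monom s w | s w. w \<in> W \<and> length w \<le> i}"
  using assms
proof (induction rule: lie_product.induct)
  case (generator v)
  have "[] \<in> W" using W letters[of True] unfolding factorial_language_def by blast
  then show ?case
    using generator letters by (intro span_base) (auto simp: generators_def word_monom_eq_iff)
next
  case (product i x j y)
  let ?B = "\<lambda>i. {word_monom s w | s w. w \<in> W \<and> length w \<le> i} :: 'f poly set"
  interpret U: lie_algebra smult UNIV "commutator W :: 'f poly \<Rightarrow> _"
    by (rule lie_algebra_commutator_words[OF W])
  show ?case
  proof (rule U.bracket_span[OF subset_UNIV subset_UNIV _ product.IH])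
    have mult: "bilinear_extension (word_mult W) (word_monom s u) (word_monom t v) \<in> span (?B k)"
      if "length u + length v \<le> k" for s u t v k
      using that by (auto simp: mult_word_monom word_monom_eq_iff intro!: span_base span_zero)
    fix p q assume "p \<in> ?B i" "q \<in> ?B j"
    then obtain s u t v where "p = word_monom s u" "q = word_monom t v"
      "length u \<le> i" "length v \<le> j" by blast
    then show "commutator W p q \<in> span (?B (i + j))"
      unfolding commutator_def by (auto intro!: span_diff mult)
  qed
qed

lemma filtration_subset_span_words:
  "filtration generators n \<subseteq> span {word_monom s w | s w. w \<in> words_upto W n}"
  unfolding filtration_def
proof (rule span_minimal, rule subsetI)
  fix p :: "'f poly" assume "p \<in> {p. \<exists>i\<le>n. lie_product generators i p}"
  then obtain i where i: "i \<le> n" "lie_product generators i p" by blast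
  have "{word_monom s w | s w. w \<in> W \<and> length w \<le> i} \<subseteq>
      ({word_monom s w | s w. w \<in> words_upto W n} :: 'f poly set)"
    using i(1) by (auto simp: words_upto_def) (use order_trans in blast)
  then show "p \<in> span {word_monom s w | s w. w \<in> words_upto W n}"
    using lie_product_in_span_words[OF i(2)] span_mono by blast
qed simp

lemma growth_generators_le: "growth generators n \<le> 2 * card (words_upto W n)"
proof -
  let ?B = "case_prod word_monom ` (UNIV \<times> words_upto W n) :: 'f poly set"
  have "growth generators n \<le> card ?B"
    unfolding growth_eq_dim_filtration
    using filtration_subset_span_words[of n] unfolding word_monoms_eq_image
    by (rule dim_le_card) (simp add: finite_words_upto)
  also have "\<dots> \<le> card (UNIV \<times> words_upto W n :: (bool \<times> bool list) set)"
    by (rule card_image_le) (simp add: finite_words_upto)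
  also have "\<dots> = 2 * card (words_upto W n)" by (simp add: card_cartesian_product)
  finally show ?thesis .
qed

text \<open>
  The words \<open>z w\<close> are distinct basis monomials, so they are linearly independent; the marker
  accounts for the shift by one.
\<close>

lemma growth_generators_ge: "card (words_upto W n) \<le> growth generators (n + 1)"
proof -
  let ?B = "word_monom True ` words_upto W n :: 'f poly set"
  have "independent ?B"
    by (rule independent_mono[OF independent_monom_1]) (auto simp: word_monom_def)
  have "?B \<subseteq> filtration generators (n + 1)"
    unfolding filtration_def
    using marked_word_is_lie_product by (force simp: words_upto_def intro!: span_base)
  then have "dim ?B \<le> dim (filtration generators (n + 1))"
    using filtration_subset_span_words[of "n + 1"] unfolding word_monoms_eq_image
    by (rule dim_mono_finitely_spanned) (simp add: finite_words_upto)
  moreover have "dim ?B = card ?B"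
    by (rule dim_eq_card_independent) fact
  moreover have "card ?B = card (words_upto W n)"
    by (rule card_image) (auto simp: inj_on_def word_monom_eq_iff)
  ultimately show ?thesis by (simp add: growth_eq_dim_filtration)
qed

end

text \<open>
  The subalgebra generated by \<open>z\<close> and the two letters is taken as the carrier. Its growth with
  respect to these three generators is counted by words, and any other generating subspace changes
  it by a factor \<open>c\<close> in the argument.
\<close>

theorem lie_algebra_with_word_growth:
  assumes W: "factorial_language W" and letters: "\<And>b. [b] \<in> W"
  obtains L and bracket :: "'f::field poly \<Rightarrow> 'f poly \<Rightarrow> 'f poly" where
    "lie_algebra smult L bracket" "lie_algebra.finitely_generated smult L bracket"
    "\<And>V. lie_algebra.fin_dim_generating_subspace smult L bracket V \<Longrightarrow>
      \<exists>c\<ge>1. (\<forall>n. lie_algebra.growth smult bracket V n \<le> 2 * card (words_upto W (c * n))) \<and>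
        (\<forall>m n. c * (m + 1) \<le> n \<longrightarrow>
          card (words_upto W m) \<le> lie_algebra.growth smult bracket V n)"
proof -
  let ?br = "commutator W :: 'f poly \<Rightarrow> _" and ?X = "generators :: 'f poly set"
  interpret U: lie_algebra smult UNIV ?br
    by (rule lie_algebra_commutator_words[OF W])
  define L where "L = U.lie_subalgebra hull ?X"
  note hull = U.lie_algebra_hull[of ?X, folded L_def, OF subset_UNIV]
  interpret lie_algebra smult L ?br by (rule hull(1))
  have fin: "finite ?X" by (simp add: generators_def)
  show thesis
  proof (rule that[OF hull(1)])
    show "finitely_generated" unfolding finitely_generated_def using fin hull(2,3) by blast
    fix V assume V: "fin_dim_generating_subspace V"
    have "\<exists>B. finite B \<and> filtration ?X n \<subseteq> U.span B" for n
      using filtration_subset_span_words[OF W letters hull(1), of n]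
      unfolding word_monoms_eq_image
      by (intro exI[of _ "case_prod word_monom ` (UNIV \<times> words_upto W n)"] conjI)
        (auto simp: finite_words_upto)
    from growth_generator_independent[OF fin hull(2,3) this V] obtain c where c: "c \<ge> 1"
      "\<And>n. growth V n \<le> growth ?X (c * n)"
      "\<And>m n. c * m \<le> n \<Longrightarrow> growth ?X m \<le> growth V n" by blast
    have "growth V n \<le> 2 * card (words_upto W (c * n))" for n
      using c(2) growth_generators_le[OF W letters hull(1)] by (rule order_trans)
    moreover have "card (words_upto W m) \<le> growth V n" if "c * (m + 1) \<le> n" for m n
      using growth_generators_ge[OF W letters hull(1)] c(3)[OF that] by (rule order_trans)
    ultimately show "\<exists>c\<ge>1. (\<forall>n. growth V n \<le> 2 * card (words_upto W (c * n))) \<and>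
        (\<forall>m n. c * (m + 1) \<le> n \<longrightarrow> card (words_upto W m) \<le> growth V n)"
      using c(1) by blast
  qed
qed

section \<open>Asymptotics of the number of sparse words\<close>

text \<open>
  Put \<open>y = n / g n\<close>. Monotonicity of \<open>n / g n\<close> gives \<open>g (c * n) \<le> c * g n\<close>, so the logarithm of the
  bound in \<open>card_sparse_words_le\<close> at \<open>c * n\<close> is \<open>y\<close> times \<open>O(1 + ln (g n))\<close>; the polynomial
  factor \<open>c * n + 1\<close> is covered by \<open>ln n \<le> y\<close>. On the other side
  \<open>n / g n powr r = y * g n powr (1 - r)\<close>, and a positive power of \<open>g n\<close> beats its logarithm.
\<close>

lemma card_sparse_words_less_exp:
  fixes r :: real and c :: nat
  assumes g1: "\<And>n. g n \<ge> 1" and mono: "mono g" "mono (\<lambda>n. real n / g n)"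
    and lim: "filterlim g at_top sequentially"
    and log: "\<forall>\<^sub>F n in sequentially. ln (real n) \<le> real n / g n"
    and c: "c \<ge> 1" and r: "r < 1"
  shows "\<forall>\<^sub>F n in sequentially.
    2 * real (card (words_upto (sparse_language g) (c * n))) < exp (real n / g n powr r)"
proof -
  define C where "C = real c"
  have C: "C \<ge> 1" using c by (simp add: C_def)
  have "\<forall>\<^sub>F x in at_top. ln (4 * C) + 1 + (C + 1) * (ln C + ln x) + C < x powr (1 - r)"
    using r C by real_asymp
  then have "\<forall>\<^sub>F n in sequentially.
      ln (4 * C) + 1 + (C + 1) * (ln C + ln (g n)) + C < g n powr (1 - r)"
    using lim by (rule eventually_compose_filterlim)
  then show ?thesis
    using log eventually_ge_at_top[of 3]
  proof eventually_elim
    case (elim n)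
    let ?N = "c * n" and ?y = "real n / g n" and ?G = "C * g n"
    have g: "g n \<ge> 1" "g ?N \<ge> 1" "g n \<le> g ?N"
      using g1 c monoD[OF mono(1), of n ?N] by auto
    have "exp 1 \<le> real n" using exp_le elim(3) by linarith
    then have "1 \<le> ln (real n)" using elim(3) by (subst ln_ge_iff) auto
    then have y: "1 \<le> ?y" using elim(2) by linarith
    have "?y \<le> real ?N / g ?N" using monoD[OF mono(2), of n ?N] c by simp
    then have gN: "g ?N \<le> ?G"
      using g elim(3) by (simp add: field_simps C_def)
    have yN: "real ?N / g ?N \<le> C * ?y"
      using g by (simp add: C_def frac_le)
    have N: "real ?N + 1 \<le> 2 * C * real n"
    proof -
      have "1 * 1 \<le> C * real n" using C elim(3) by (intro mult_mono) auto
      then show ?thesis by (simp add: C_def)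
    qed
    have "real (card (words_upto (sparse_language g) ?N))
        \<le> (real ?N + 1) * g ?N powr (real ?N / g ?N + 1) * exp (real ?N / g ?N)"
      using g1 mono(2) by (rule card_sparse_words_le)
    also have "\<dots> \<le> (2 * C * real n) * ?G powr (C * ?y + 1) * exp (C * ?y)"
    proof (intro mult_mono)
      have "g ?N powr (real ?N / g ?N + 1) \<le> ?G powr (real ?N / g ?N + 1)"
        using gN g by (intro powr_mono2) auto
      also have "\<dots> \<le> ?G powr (C * ?y + 1)"
        using gN g yN by (intro powr_mono) auto
      finally show "g ?N powr (real ?N / g ?N + 1) \<le> ?G powr (C * ?y + 1)" .
    qed (use N yN C g in auto)
    finally have "2 * real (card (words_upto (sparse_language g) ?N))
        \<le> 2 * ((2 * C * real n) * ?G powr (C * ?y + 1) * exp (C * ?y))"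
      by (rule mult_left_mono) simp
    also have "\<dots> = (4 * C) * real n * ?G powr (C * ?y + 1) * exp (C * ?y)" by simp
    also have "\<dots> = exp (ln (4 * C) + ln (real n) + (C * ?y + 1) * (ln C + ln (g n)) + C * ?y)"
      using C g elim(3) by (simp add: exp_add powr_def ln_mult)
    also have "\<dots> \<le> exp (?y * (ln (4 * C) + 1 + (C + 1) * (ln C + ln (g n)) + C))"
    proof -
      have "ln (4 * C) * 1 \<le> ln (4 * C) * ?y" using C y by (intro mult_left_mono) auto
      moreover have "1 * (ln C + ln (g n)) \<le> ?y * (ln C + ln (g n))"
        using C g y by (intro mult_right_mono) auto
      ultimately show ?thesis using elim(2) by (simp add: algebra_simps add_divide_distrib)
    qed
    also have "\<dots> < exp (?y * g n powr (1 - r))"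
    proof -
      have "0 < ?y" using y by linarith
      then show ?thesis using elim(1) by (intro exp_less_mono mult_strict_left_mono)
    qed
    also have "?y * g n powr (1 - r) = real n / g n powr r"
      using g by (simp add: powr_diff)
    finally show ?case .
  qed
qed

lemma real_div_minus_one_le: "real m / real n - 1 \<le> real (m div n)"
proof -
  have "real (m div n) = of_int \<lfloor>real m / real n\<rfloor>" by (simp add: floor_divide_of_nat_eq)
  then show ?thesis by linarith
qed

text \<open>
  At length \<open>m = n div c - 1\<close>, blocks of size about \<open>g n\<close> already fit the quota, and there are
  \<open>m div d \<ge> n / (8 * c * g n)\<close> free choices. This beats
  \<open>n / g n powr r = (n / g n) * g n powr (1 - r)\<close>, because \<open>g n powr (1 - r)\<close> tends to zero.
\<close>

lemma exp_less_card_sparse_words: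
  fixes r :: real and c :: nat
  assumes g1: "\<And>n. g n \<ge> 1" and mono: "mono g"
    and lim: "filterlim g at_top sequentially"
    and lim': "filterlim (\<lambda>n. real n / g n) at_top sequentially"
    and c: "c \<ge> 1" and r: "r > 1"
  shows "\<forall>\<^sub>F n in sequentially.
    exp (real n / g n powr r) < real (card (words_upto (sparse_language g) (n div c - 1)))"
proof -
  define C where "C = real c"
  have C: "C \<ge> 1" using c by (simp add: C_def)
  have "\<forall>\<^sub>F x in at_top. x powr (1 - r) < ln 2 / (8 * C)"
    using r C by real_asymp
  then have "\<forall>\<^sub>F n in sequentially. g n powr (1 - r) < ln 2 / (8 * C)"
    using lim by (rule eventually_compose_filterlim)
  moreover have "\<forall>\<^sub>F n in sequentially. 8 * C \<le> real n / g n"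
    using lim' by (simp add: filterlim_at_top)
  ultimately show ?thesis
    using eventually_ge_at_top[of "4 * c"]
  proof eventually_elim
    case (elim n)
    let ?m = "n div c - 1" and ?y = "real n / g n"
    define d where "d = nat \<lceil>g n\<rceil>"
    have g: "g n \<ge> 1" using g1 .
    have d: "g n \<le> real d" "real d \<le> 2 * g n" unfolding d_def using g by linarith+
    have d1: "d \<ge> 1" using d g by linarith
    have y: "0 < ?y" using elim(2) C by linarith
    have "real n / C - 1 \<le> real (n div c)"
      using real_div_minus_one_le[of n c] by (simp add: C_def)
    moreover have "4 \<le> n div c" using elim(3) c by (simp add: less_eq_div_iff_mult_less_eq)
    ultimately have "real n / C - 2 \<le> real ?m" by simp
    moreover have "2 \<le> real n / (2 * C)"
      using elim(3) C by (simp add: C_def field_simps flip: of_nat_mult)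
    ultimately have m: "real n / (2 * C) \<le> real ?m"
      by (simp add: field_simps)
    have "?y / (4 * C) - 1 = real n / (2 * C) / (2 * g n) - 1" using g C by (simp add: field_simps)
    also have "\<dots> \<le> real ?m / real d - 1"
      using m d g C by (intro diff_right_mono frac_le) auto
    also have "\<dots> \<le> real (?m div d)" by (rule real_div_minus_one_le)
    finally have div: "?y / (4 * C) - 1 \<le> real (?m div d)" .
    have "1 \<le> ?y / (8 * C)" using elim(2) C by (subst le_divide_eq_1_pos) auto
    then have "?y / (8 * C) \<le> ?y / (4 * C) - 1" by (simp add: field_simps)
    then have bound: "?y / (8 * C) \<le> real (?m div d)" using div by (rule order_trans)
    have "real n / g n powr r = ?y * g n powr (1 - r)" using g by (simp add: powr_diff)
    also have "\<dots> < ?y * (ln 2 / (8 * C))" using elim(1) y by (rule mult_strict_left_mono)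
    also have "\<dots> = ln 2 * (?y / (8 * C))" by simp
    also have "\<dots> \<le> ln 2 * real (?m div d)" using bound by (intro mult_left_mono) auto
    finally have "exp (real n / g n powr r) < exp (ln 2 * real (?m div d))" by simp
    also have "\<dots> = 2 ^ (?m div d)" by (simp add: exp_of_nat2_mult)
    also have "\<dots> \<le> real (card (words_upto (sparse_language g) ?m))"
    proof -
      have "?m \<le> n" using div_le_dividend[of n c] by linarith
      then have "g ?m \<le> real d" using monoD[OF mono, of ?m n] d by linarith
      then have "2 ^ (?m div d) \<le> card (words_upto (sparse_language g) ?m)"
        by (rule card_sparse_words_ge[OF g1 mono])
      then have "real (2 ^ (?m div d)) \<le> real (card (words_upto (sparse_language g) ?m))"
        by (rule of_nat_mono)
      then show ?thesis by simp
    qed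
    finally show ?case .
  qed
qed

section \<open>Gap functions built from iterated logarithms\<close>

lemma filterlim_iterated_ln: "filterlim ((ln ^^ k) :: real \<Rightarrow> real) at_top at_top"
proof (induction k)
  case 0
  show ?case by (simp add: id_def filterlim_ident)
next
  case (Suc k)
  show ?case using filterlim_compose[OF ln_at_top Suc] by (simp add: comp_def)
qed

lemma iterated_ln_large: "\<forall>\<^sub>F x in at_top. \<forall>y\<ge>x. K \<le> (ln ^^ k) (y :: real)"
proof -
  have "\<forall>\<^sub>F x in at_top. K \<le> (ln ^^ k) (x :: real)"
    using filterlim_iterated_ln[of k] by (simp add: filterlim_at_top)
  then show ?thesis by (rule eventually_all_ge_at_top)
qed

lemma iterated_ln_mono: "\<forall>\<^sub>F x in at_top. \<forall>y\<ge>x. (ln ^^ k) x \<le> (ln ^^ k) (y :: real)"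
proof (induction k)
  case (Suc k)
  then show ?case using iterated_ln_large[of 1 k]
  proof eventually_elim
    case (elim x)
    show ?case
    proof (intro allI impI)
      fix y assume "x \<le> y"
      then have "1 \<le> (ln ^^ k) x" "(ln ^^ k) x \<le> (ln ^^ k) y" using elim by auto
      then show "(ln ^^ Suc k) x \<le> (ln ^^ Suc k) y" by simp
    qed
  qed
qed simp

text \<open>
  Multiplying the argument by \<open>t\<close> adds \<open>ln t \<le> (t powr \<delta> - 1) / \<delta>\<close> to the logarithm, which is at
  most the fraction \<open>t powr \<delta> - 1\<close> of \<open>ln u\<close> once \<open>ln u \<ge> 1 / \<delta>\<close>.
\<close>

lemma ln_mult_le_powr_mult_ln:
  fixes t u \<delta> :: real
  assumes "t \<ge> 1" "\<delta> > 0" "u \<ge> 1" "1 / \<delta> \<le> ln u"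
  shows "ln (t * u) \<le> t powr \<delta> * ln u"
proof -
  have "\<delta> * ln t \<le> t powr \<delta> - 1"
    using ln_le_minus_one[of "t powr \<delta>"] assms(1) by (simp add: ln_powr)
  then have "ln t \<le> (t powr \<delta> - 1) * (1 / \<delta>)"
    using assms(2) by (simp add: field_simps)
  also have "\<dots> \<le> (t powr \<delta> - 1) * ln u"
    using assms by (intro mult_left_mono) (auto simp: ge_one_powr_ge_zero)
  finally show ?thesis using assms by (simp add: ln_mult algebra_simps)
qed

text \<open>
  A derivative-free form of slow growth. The loss from \<open>t\<close> to \<open>t powr \<delta>\<close> with arbitrarily small
  \<open>\<delta>\<close> happens at the outermost logarithm, so for the inner ones the factor \<open>t\<close> suffices.
\<close>

lemma iterated_ln_scale_Suc:
  assumes "\<forall>\<^sub>F x in at_top. \<forall>t\<ge>1. (ln ^^ k) (t * x) \<le> t * (ln ^^ k) (x :: real)" and \<delta>: "\<delta> > 0"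
  shows "\<forall>\<^sub>F x in at_top. \<forall>t\<ge>1. (ln ^^ Suc k) (t * x) \<le> t powr \<delta> * (ln ^^ Suc k) (x :: real)"
  using assms(1) iterated_ln_large[of 1 k] iterated_ln_large[of "1 / \<delta>" "Suc k"]
    eventually_ge_at_top[of 0]
proof eventually_elim
  case (elim x)
  show ?case
  proof (intro allI impI)
    fix t :: real assume t: "1 \<le> t"
    have "1 * x \<le> t * x" using t elim(4) by (intro mult_right_mono) auto
    then have B: "1 \<le> (ln ^^ k) (t * x)" using elim(2) by simp
    have "(ln ^^ Suc k) (t * x) = ln ((ln ^^ k) (t * x))" by simp
    also have "\<dots> \<le> ln (t * (ln ^^ k) x)" using B elim(1) t by (intro ln_mono) auto
    also have "\<dots> \<le> t powr \<delta> * ln ((ln ^^ k) x)"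
      using elim(2,3) t \<delta> by (intro ln_mult_le_powr_mult_ln) auto
    finally show "(ln ^^ Suc k) (t * x) \<le> t powr \<delta> * (ln ^^ Suc k) x" by simp
  qed
qed

lemma iterated_ln_scale: "\<forall>\<^sub>F x in at_top. \<forall>t\<ge>1. (ln ^^ k) (t * x) \<le> t * (ln ^^ k) (x :: real)"
proof (induction k)
  case (Suc k)
  from iterated_ln_scale_Suc[OF Suc, of 1] show ?case
    by (rule eventually_mono) (auto simp del: funpow.simps)
qed simp

lemma iterated_ln_le_ln: "\<forall>\<^sub>F x in at_top. (ln ^^ Suc k) x \<le> ln (x :: real)"
proof (induction k)
  case (Suc k)
  then show ?case using iterated_ln_large[of 1 "Suc k"]
  proof eventually_elim
    case (elim x)
    then have "ln ((ln ^^ Suc k) x) \<le> (ln ^^ Suc k) x - 1"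
      by (intro ln_le_minus_one) (auto dest: spec[of _ x])
    moreover have "(ln ^^ Suc (Suc k)) x = ln ((ln ^^ Suc k) x)" by simp
    ultimately show ?case using elim(1) by linarith
  qed
qed simp

text \<open>
  Let \<open>G x = B x powr e\<close> with \<open>B\<close> the iterated logarithm. The scaling estimate with \<open>\<delta> = 1 / e\<close>
  reads \<open>G (t * x) \<le> t * G x\<close>, that is, \<open>x / G x\<close> is monotone. All of this holds only beyond some
  \<open>n0\<close>; below it \<open>g\<close> is constant, which preserves the monotonicity of both \<open>g\<close> and \<open>n / g n\<close>. For \<open>k = 0\<close> the condition \<open>e < 1\<close> keeps \<open>n / g n\<close> unbounded.
\<close>

lemma obtain_gap_function:
  fixes e :: real
  assumes e: "e > 0" "k = 0 \<longrightarrow> e < 1"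
  obtains g :: "nat \<Rightarrow> real" where "\<And>n. g n \<ge> 1" "mono g" "mono (\<lambda>n. real n / g n)"
    "filterlim g at_top sequentially" "\<forall>\<^sub>F n in sequentially. ln (real n) \<le> real n / g n"
    "\<forall>\<^sub>F n in sequentially. g n = (ln ^^ k) (real n) powr e"
proof -
  let ?B = "ln ^^ k :: real \<Rightarrow> real"
  define G where "G = (\<lambda>x. ?B x powr e)"
  have scale: "\<forall>\<^sub>F x in at_top. \<forall>t\<ge>1. ?B (t * x) \<le> t powr (1 / e) * ?B x"
  proof (cases k)
    case 0
    have "t \<le> t powr (1 / e)" if "t \<ge> 1" for t :: real
      using powr_mono[of 1 "1 / e" t] that e 0 by simp
    then show ?thesis
      using eventually_ge_at_top[of "0 :: real"] unfolding 0
      by (elim eventually_mono) (auto intro: mult_right_mono)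
  next
    case (Suc k')
    show ?thesis unfolding Suc using e(1) by (intro iterated_ln_scale_Suc[OF iterated_ln_scale]) simp
  qed
  obtain a where a: "\<And>x y. a \<le> x \<Longrightarrow> x \<le> y \<Longrightarrow> ?B x \<le> ?B y" "\<And>x. a \<le> x \<Longrightarrow> 1 \<le> ?B x"
    "\<And>x t. a \<le> x \<Longrightarrow> 1 \<le> t \<Longrightarrow> ?B (t * x) \<le> t powr (1 / e) * ?B x"
    using eventually_conj[OF iterated_ln_mono[of k] eventually_conj[OF iterated_ln_large[of 1 k] scale]]
    unfolding eventually_at_top_linorder by blast
  define n0 where "n0 = nat \<lceil>max a 1\<rceil>"
  have n0: "a \<le> real n0" "1 \<le> n0" unfolding n0_def by linarith+
  have G1: "1 \<le> G x" if "a \<le> x" for x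
    using a(2)[OF that] e(1) by (simp add: G_def ge_one_powr_ge_zero)
  have G_mono: "G x \<le> G y" if "a \<le> x" "x \<le> y" for x y
    using a(1)[OF that] a(2)[OF that(1)] e(1) by (simp add: G_def powr_mono2)
  have G_scale: "x / G x \<le> y / G y" if "a \<le> x" "x \<le> y" "0 < x" for x y
  proof -
    have "?B y \<le> (y / x) powr (1 / e) * ?B x" using a(3)[of x "y / x"] that by simp
    then have "G y \<le> ((y / x) powr (1 / e) * ?B x) powr e"
      unfolding G_def using a(2)[of y] that e(1) by (intro powr_mono2) auto
    also have "\<dots> = y / x * G x"
      using that e(1) a(2)[of x] by (simp add: G_def powr_mult powr_powr)
    finally show ?thesis using G1[of x] G1[of y] that by (simp add: field_simps)
  qed
  define g where "g n = G (real (max n n0))" for n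
  have g1: "g n \<ge> 1" for n unfolding g_def using n0 by (intro G1) auto
  have ev: "\<forall>\<^sub>F n in sequentially. g n = ?B (real n) powr e"
    using eventually_ge_at_top[of n0] by eventually_elim (simp add: g_def G_def max_def)
  have "mono g"
    unfolding g_def using n0 by (intro monoI G_mono) (auto simp: max_def)
  moreover have "mono (\<lambda>n. real n / g n)"
  proof (rule monoI)
    fix m n :: nat assume "m \<le> n"
    let ?x = "real (max m n0)" and ?y = "real (max n n0)"
    show "real m / g m \<le> real n / g n"
    proof (cases "n \<le> n0")
      case True
      then have "g m = g n" using \<open>m \<le> n\<close> by (simp add: g_def max_def)
      then show ?thesis using \<open>m \<le> n\<close> g1[of n] by (simp add: divide_right_mono)
    next
      case False
      have "real m / g m \<le> ?x / G ?x" using g1[of m] by (auto simp: g_def intro!: divide_right_mono)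
      also have "\<dots> \<le> ?y / G ?y" using n0 \<open>m \<le> n\<close> by (intro G_scale) auto
      also have "\<dots> = real n / g n" using False by (simp add: g_def max_def)
      finally show ?thesis .
    qed
  qed
  moreover have "filterlim g at_top sequentially"
  proof -
    have "filterlim (\<lambda>x :: real. x powr e) at_top at_top" using e(1) by real_asymp
    then have "filterlim (\<lambda>n. ?B (real n) powr e) at_top sequentially"
      using filterlim_compose[OF filterlim_iterated_ln filterlim_real_sequentially]
      by (rule filterlim_compose)
    then show ?thesis using ev by (simp add: filterlim_cong)
  qed
  moreover have "\<forall>\<^sub>F n in sequentially. ln (real n) \<le> real n / g n"
  proof -
    have "\<forall>\<^sub>F x in at_top. ln x * ?B x powr e \<le> x"
    proof (cases k)
      case 0
      have "e < 1" using e(2) 0 by simp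
      then have "\<forall>\<^sub>F x::real in at_top. ln x * x powr e \<le> x" by real_asymp
      then show ?thesis by (simp add: 0)
    next
      case (Suc k')
      have "\<forall>\<^sub>F x::real in at_top. ln x * ln x powr e \<le> x" by real_asymp
      then show ?thesis
        using iterated_ln_le_ln[of k'] iterated_ln_large[of 1 k] eventually_ge_at_top[of 1]
      proof eventually_elim
        case (elim x)
        have "1 \<le> ?B x" using elim(3) by blast
        then have "ln x * ?B x powr e \<le> ln x * ln x powr e"
          using elim(2,4) e(1) unfolding Suc by (intro mult_left_mono powr_mono2) auto
        then show ?case using elim(1) by linarith
      qed
    qed
    then have "\<forall>\<^sub>F n in sequentially. ln (real n) * ?B (real n) powr e \<le> real n"
      using filterlim_real_sequentially by (rule eventually_compose_filterlim)
    then show ?thesis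
      using ev
    proof eventually_elim
      case (elim n)
      have "0 < g n" using g1[of n] by linarith
      then show ?case using elim by (simp add: pos_le_divide_eq)
    qed
  qed
  ultimately show thesis using that g1 ev by blast
qed

section \<open>The q-dimensions\<close>

text \<open>
  For \<open>q = 3\<close> this is \<open>1 - \<alpha> / (\<alpha> + 1)\<close>, which puts \<open>Phi 3\<close> into the same shape as the other cases.
\<close>

definition Phi_exponent :: "nat \<Rightarrow> real \<Rightarrow> real" where
  "Phi_exponent q \<alpha> = (if q = 3 then 1 / (\<alpha> + 1) else 1 / \<alpha>)"

lemma Phi_eq:
  assumes "\<alpha> > 0" "n \<ge> 1"
  shows "Phi q \<alpha> n = exp (real n / (ln ^^ (q - 3)) (real n) powr Phi_exponent q \<alpha>)"
proof -
  have "\<alpha> / (\<alpha> + 1) = 1 - 1 / (\<alpha> + 1)" using assms(1) by (simp add: field_simps)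
  then show ?thesis using assms(2) by (simp add: Phi_def Phi_exponent_def powr_diff)
qed

text \<open>
  Strict bounds on both sides of \<open>\<sigma>\<close> decide, for every positive \<open>\<alpha> \<noteq> \<sigma>\<close>, membership in both of the sets
  that define the two dimensions.
\<close>

lemma qdim_eqI:
  assumes \<sigma>: "\<sigma> > 0"
    and above: "\<And>\<alpha>. \<alpha> > \<sigma> \<Longrightarrow> \<forall>\<^sub>F n in sequentially. f n < Phi q \<alpha> n"
    and below: "\<And>\<alpha>. 0 < \<alpha> \<Longrightarrow> \<alpha> < \<sigma> \<Longrightarrow> \<forall>\<^sub>F n in sequentially. Phi q \<alpha> n < f n"
  shows "upper_qdim q f = ennreal \<sigma>" "lower_qdim q f = ennreal \<sigma>"
proof -
  show "upper_qdim q f = ennreal \<sigma>"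
  proof (rule antisym)
    show "upper_qdim q f \<le> ennreal \<sigma>"
    proof (rule ennreal_le_epsilon)
      fix e :: real assume e: "0 < e"
      have "upper_qdim q f \<le> ennreal (\<sigma> + e)"
        unfolding upper_qdim_def
        using above[of "\<sigma> + e"] e \<sigma> by (intro Inf_lower imageI) (auto elim: eventually_mono)
      then show "upper_qdim q f \<le> ennreal \<sigma> + ennreal e" using e \<sigma> by simp
    qed
    show "ennreal \<sigma> \<le> upper_qdim q f"
      unfolding upper_qdim_def
    proof (rule INF_greatest)
      fix \<alpha> assume \<alpha>: "\<alpha> \<in> {\<alpha>. \<alpha> > 0 \<and> (\<forall>\<^sub>F n in sequentially. f n \<le> Phi q \<alpha> n)}"
      have "\<sigma> \<le> \<alpha>"
      proof (rule ccontr)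
        assume "\<not> \<sigma> \<le> \<alpha>"
        then have "\<forall>\<^sub>F n in sequentially. Phi q \<alpha> n < f n" using \<alpha> by (intro below) auto
        moreover have "\<forall>\<^sub>F n in sequentially. f n \<le> Phi q \<alpha> n" using \<alpha> by blast
        ultimately have "\<forall>\<^sub>F n :: nat in sequentially. False" by eventually_elim simp
        then show False by simp
      qed
      then show "ennreal \<sigma> \<le> ennreal \<alpha>" by (rule ennreal_leI)
    qed
  qed
  show "lower_qdim q f = ennreal \<sigma>"
  proof (rule antisym)
    show "ennreal \<sigma> \<le> lower_qdim q f"
    proof (rule dense_le)
      fix x assume x: "x < ennreal \<sigma>"
      then obtain a where a: "x = ennreal a" "0 \<le> a" by (cases x) auto
      then have "a < \<sigma>" using x \<sigma> by (simp add: ennreal_less_iff)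
      then have "ennreal ((a + \<sigma>) / 2) \<le> lower_qdim q f"
        unfolding lower_qdim_def
        using below[of "(a + \<sigma>) / 2"] a \<sigma> by (intro Sup_upper imageI) (auto elim: eventually_mono)
      moreover have "x \<le> ennreal ((a + \<sigma>) / 2)"
        unfolding a(1) using \<open>a < \<sigma>\<close> by (intro ennreal_leI) simp
      ultimately show "x \<le> lower_qdim q f" by (rule order_trans[rotated])
    qed
    show "lower_qdim q f \<le> ennreal \<sigma>"
      unfolding lower_qdim_def
    proof (rule SUP_least)
      fix \<alpha> assume \<alpha>: "\<alpha> \<in> {\<alpha>. \<alpha> > 0 \<and> (\<forall>\<^sub>F n in sequentially. f n \<ge> Phi q \<alpha> n)}"
      have "\<alpha> \<le> \<sigma>"
      proof (rule ccontr)
        assume "\<not> \<alpha> \<le> \<sigma>"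
        then have "\<forall>\<^sub>F n in sequentially. f n < Phi q \<alpha> n" by (intro above) auto
        moreover have "\<forall>\<^sub>F n in sequentially. Phi q \<alpha> n \<le> f n" using \<alpha> by blast
        ultimately have "\<forall>\<^sub>F n :: nat in sequentially. False" by eventually_elim simp
        then show False by simp
      qed
      then show "ennreal \<alpha> \<le> ennreal \<sigma>" by (rule ennreal_leI)
    qed
  qed
qed

theorem corollary6p1:
  fixes q :: nat and \<sigma> :: real
  assumes "CHAR('f::field) \<noteq> 2"
    and "q \<ge> 3"
    and "0 < \<sigma>" and "\<sigma> < 1"
  shows "\<exists>(L :: 'f poly set) (bracket :: 'f poly \<Rightarrow> 'f poly \<Rightarrow> 'f poly).
    lie_algebra smult L bracket \<and>
    lie_algebra.finitely_generated smult L bracket \<and>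
    (\<forall>V. lie_algebra.fin_dim_generating_subspace smult L bracket V \<longrightarrow>
       upper_qdim q (\<lambda>n. real (lie_algebra.growth smult bracket V n)) = ennreal \<sigma> \<and>
       lower_qdim q (\<lambda>n. real (lie_algebra.growth smult bracket V n)) = ennreal \<sigma>)"
proof -
  let ?e = "Phi_exponent q"
  have e: "?e \<sigma> > 0" "q - 3 = 0 \<longrightarrow> ?e \<sigma> < 1"
    using assms(2,3) by (auto simp: Phi_exponent_def)
  obtain g where g: "\<And>n. g n \<ge> 1" "mono g" "mono (\<lambda>n. real n / g n)"
    "filterlim g at_top sequentially" "\<forall>\<^sub>F n in sequentially. ln (real n) \<le> real n / g n"
    and g_eq: "\<forall>\<^sub>F n in sequentially. g n = (ln ^^ (q - 3)) (real n) powr ?e \<sigma>"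
    by (rule obtain_gap_function[OF e]) (rule that; assumption)
  have g': "filterlim (\<lambda>n. real n / g n) at_top sequentially"
    using filterlim_at_top_mono[OF filterlim_compose[OF ln_at_top filterlim_real_sequentially] g(5)] .
  let ?W = "sparse_language g"
  have Phi: "\<forall>\<^sub>F n in sequentially. Phi q \<alpha> n = exp (real n / g n powr (?e \<alpha> / ?e \<sigma>))"
    if "\<alpha> > 0" for \<alpha>
    using g_eq eventually_ge_at_top[of 1]
    by eventually_elim (use that e(1) in \<open>simp add: Phi_eq powr_powr\<close>)
  obtain L and bracket :: "'f poly \<Rightarrow> 'f poly \<Rightarrow> 'f poly" where
    L: "lie_algebra smult L bracket" "lie_algebra.finitely_generated smult L bracket"
    and growth: "\<And>V. lie_algebra.fin_dim_generating_subspace smult L bracket V \<Longrightarrow>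
      \<exists>c\<ge>1. (\<forall>n. lie_algebra.growth smult bracket V n \<le> 2 * card (words_upto ?W (c * n))) \<and>
        (\<forall>m n. c * (m + 1) \<le> n \<longrightarrow>
          card (words_upto ?W m) \<le> lie_algebra.growth smult bracket V n)"
    by (rule lie_algebra_with_word_growth[OF factorial_sparse_language
          singleton_in_sparse_language[OF g(1)]]) (rule that; assumption)
  have "upper_qdim q (\<lambda>n. real (lie_algebra.growth smult bracket V n)) = ennreal \<sigma> \<and>
      lower_qdim q (\<lambda>n. real (lie_algebra.growth smult bracket V n)) = ennreal \<sigma>"
    if V: "lie_algebra.fin_dim_generating_subspace smult L bracket V" for V
  proof -
    obtain c where c: "c \<ge> 1"
      and le: "\<And>n. lie_algebra.growth smult bracket V n \<le> 2 * card (words_upto ?W (c * n))"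
      and ge: "\<And>m n. c * (m + 1) \<le> n \<Longrightarrow>
        card (words_upto ?W m) \<le> lie_algebra.growth smult bracket V n"
      using growth[OF V] by blast
    have "\<forall>\<^sub>F n in sequentially. real (lie_algebra.growth smult bracket V n) < Phi q \<alpha> n"
      if "\<alpha> > \<sigma>" for \<alpha>
    proof -
      have r: "?e \<alpha> / ?e \<sigma> < 1" and "\<alpha> > 0"
        using that assms(3) by (auto simp: Phi_exponent_def field_simps)
      show ?thesis
        using card_sparse_words_less_exp[OF g c r] Phi[OF \<open>\<alpha> > 0\<close>]
      proof eventually_elim
        case (elim n)
        have "real (lie_algebra.growth smult bracket V n) \<le> real (2 * card (words_upto ?W (c * n)))"
          by (rule of_nat_mono[OF le])
        then show ?case using elim by simp
      qed
    qed
    moreover have "\<forall>\<^sub>F n in sequentially. Phi q \<alpha> n < real (lie_algebra.growth smult bracket V n)"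
      if "0 < \<alpha>" "\<alpha> < \<sigma>" for \<alpha>
    proof -
      have r: "?e \<alpha> / ?e \<sigma> > 1"
        using that by (auto simp: Phi_exponent_def field_simps)
      show ?thesis
        using exp_less_card_sparse_words[OF g(1,2,4) g' c r] Phi[OF that(1)]
          eventually_ge_at_top[of c]
      proof eventually_elim
        case (elim n)
        have "1 \<le> n div c" using elim(3) c by (simp add: less_eq_div_iff_mult_less_eq)
        then have "c * (n div c - 1 + 1) \<le> n" by simp
        then have "card (words_upto ?W (n div c - 1)) \<le> lie_algebra.growth smult bracket V n"
          by (rule ge)
        then have "real (card (words_upto ?W (n div c - 1)))
            \<le> real (lie_algebra.growth smult bracket V n)" by (rule of_nat_mono)
        then show ?case using elim by linarith
      qed
    qed
    ultimately show ?thesis by (intro conjI qdim_eqI[OF assms(3)])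
  qed
  then show ?thesis using L by blast
qed

end
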